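(* Let $\psi:\mathbb{Z}\to\mathbb{R}$ be a partially defined positivity preserver. Then there are real numbers $a_i\ge 0$ ($i=0,1,2,\dots$) with $\limsup_{n\to\infty} a_n^{1/n}=0$ such that $$\psi(x)=\sum_{i=0}^{\infty} a_i x^i\qquad\text{for all }x\in\mathbb{Z}.$$
   Context: A real symmetric square matrix $[m_{ij}]$ is positive semidefinite if $\sum_{i,j}c_ic_jm_{ij}\ge 0$ for all real $c_1,\dots,c_N$. A partially defined matrix is a square matrix of finite size in which some entries (possibly including diagonal ones) are left unspecified. It is called positive semidefinite if one can substitute real values for the unspecified entries so that the resulting matrix is symmetric and positive semidefinite (a positive semidefinite completion). For $X\subseteq\mathbb{R}$, a function $f:X\to\mathbb{R}$ is a partially defined positivity preserver if for every partially defined positive semidefinite matrix $[m_{ij}]$ whose specified entries lie in $X$, the partially defined matrix $[f(m_{ij})]$ is again positive semidefinite, where $f$ of an unspecified entry is left unspecified. *)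

theory Defs
  imports "HOL-Library.Extended_Real" "Jordan_Normal_Form.Matrix"
begin

definition pos_semidef_mat :: "real mat \<Rightarrow> bool" where
  "pos_semidef_mat A \<longleftrightarrow>
     square_mat A \<and> A\<^sup>T = A \<and>
     (\<forall>c :: nat \<Rightarrow> real. (\<Sum>i<dim_row A. \<Sum>j<dim_row A. c i * c j * A $$ (i, j)) \<ge> 0)"

text \<open>A partially defined real matrix is a square matrix over \<^typ>\<open>real option\<close>;
  the entries \<^const>\<open>None\<close> are the unspecified ones.\<close>

definition completion_of :: "real mat \<Rightarrow> real option mat \<Rightarrow> bool" where
  "completion_of B A \<longleftrightarrow>
     dim_row B = dim_row A \<and> dim_col B = dim_col A \<and>
     (\<forall>i < dim_row A. \<forall>j < dim_col A. \<forall>x. A $$ (i, j) = Some x \<longrightarrow> B $$ (i, j) = x)"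

definition partial_pos_semidef_mat :: "real option mat \<Rightarrow> bool" where
  "partial_pos_semidef_mat A \<longleftrightarrow>
     square_mat A \<and> (\<exists>B. completion_of B A \<and> pos_semidef_mat B)"

text \<open>A function from \<open>X\<close> to the reals is represented by a total function of type
  \<^typ>\<open>real \<Rightarrow> real\<close>, whose values outside \<open>X\<close> are never used.\<close>

definition partial_positivity_preserver :: "real set \<Rightarrow> (real \<Rightarrow> real) \<Rightarrow> bool" where
  "partial_positivity_preserver X f \<longleftrightarrow>
     (\<forall>A :: real option mat.
        partial_pos_semidef_mat A \<and>
        (\<forall>i < dim_row A. \<forall>j < dim_col A. \<forall>x. A $$ (i, j) = Some x \<longrightarrow> x \<in> X) \<longrightarrow>
        partial_pos_semidef_mat (map_mat (map_option f) A))"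

end

theory Submission
  imports Defs "HOL-Analysis.Summation_Tests" "HOL-Library.Diagonal_Subsequence"
    "HOL-Combinatorics.Transposition"
begin

text \<open>
  Fix \<open>N\<close> and an even \<open>D\<close>, and put \<open>d = 2ND\<close>. The vertices of the cube \<open>{-1, 1}\<^sup>d\<close>, scaled to length
  \<open>\<surd>N\<close>, have a Gram matrix whose entry at Hamming distance \<open>tD\<close> is the integer \<open>N - t\<close>. Applying
  \<open>\<psi>\<close> to the integral entries and completing gives a positive semidefinite matrix; expanding it in the
  characters of the Boolean group \<open>{-1, 1}\<^sup>d\<close> and averaging over the points of weight \<open>tD\<close> shows that
  \<open>\<psi>(N - t)\<close> is a nonnegative combination of normalised Krawtchouk values \<open>\<kappa>\<^sub>k(tD)\<close> with total
  coefficient \<open>\<psi>(N)\<close>. As \<open>D \<rightarrow> \<infinity>\<close>, \<open>\<kappa>\<^sub>k(tD) \<rightarrow> ((N - t) / N)\<^sup>k\<close> for each fixed \<open>k\<close>, and a uniform bound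
  for large \<open>k\<close> lets the limit pass through the sum, giving a power series with nonnegative
  coefficients that agrees with \<open>\<psi>\<close> on the integers in \<open>(-N, N)\<close>. A second diagonal limit
  \<open>N \<rightarrow> \<infinity>\<close>, in which the value \<open>\<psi>(M)\<close> controls the tails on \<open>(-M, M)\<close>, gives the entire series.
\<close>

section \<open>Partially defined matrices as kernels on finite sets\<close>

text \<open>Lets the vertices of a cube serve directly as matrix indices. Entries outside
  \<open>X\<close> become unspecified, \<open>M\<close> itself completes what remains, and
  \<open>K\<close> comes from a completion of the image matrix.\<close>

lemma partial_positivity_preserver_kernel:
  assumes f: "partial_positivity_preserver X f"
    and I: "finite (I :: 'a set)"
    and sym: "\<And>x y. x \<in> I \<Longrightarrow> y \<in> I \<Longrightarrow> M x y = M y x"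
    and psd: "\<And>c :: 'a \<Rightarrow> real. (\<Sum>x\<in>I. \<Sum>y\<in>I. c x * c y * M x y) \<ge> 0"
  obtains K :: "'a \<Rightarrow> 'a \<Rightarrow> real"
  where "\<And>c :: 'a \<Rightarrow> real. (\<Sum>x\<in>I. \<Sum>y\<in>I. c x * c y * K x y) \<ge> 0"
    and "\<And>x y. x \<in> I \<Longrightarrow> y \<in> I \<Longrightarrow> M x y \<in> X \<Longrightarrow> K x y = f (M x y)"
proof -
  define n where "n = card I"
  obtain e where "bij_betw e {0..<card I} I"
    using ex_bij_betw_nat_finite[OF I] by blast
  then have e: "bij_betw e {..<n} I"
    by (simp add: n_def atLeast0LessThan)
  then have eI: "e i \<in> I" if "i < n" for i
    using that by (auto dest: bij_betwE)
  define e' where "e' = inv_into {..<n} e"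
  have e': "e' x < n" "e (e' x) = x" if "x \<in> I" for x
    using that e bij_betw_inv_into_right[OF e] bij_betwE[OF bij_betw_inv_into[OF e]]
    by (auto simp: e'_def)
  have e'e: "e' (e i) = i" if "i < n" for i
    using that bij_betw_inv_into_left[OF e] by (auto simp: e'_def)
  have transfer: "(\<Sum>x\<in>I. \<Sum>y\<in>I. g x y) = (\<Sum>i<n. \<Sum>j<n. g (e i) (e j))"
    for g :: "'a \<Rightarrow> 'a \<Rightarrow> real"
    by (subst sum.reindex_bij_betw[OF e, symmetric], rule sum.cong[OF refl],
        subst sum.reindex_bij_betw[OF e, symmetric]) (rule refl)
  define A where "A = Matrix.mat n n (\<lambda>(i, j). if M (e i) (e j) \<in> X then Some (M (e i) (e j)) else None)"
  define B where "B = Matrix.mat n n (\<lambda>(i, j). M (e i) (e j))"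
  have "pos_semidef_mat B"
    unfolding pos_semidef_mat_def
  proof (intro conjI allI)
    show "square_mat B" by (simp add: B_def)
    show "B\<^sup>T = B" using sym eI by (intro eq_matI) (auto simp: B_def)
    fix c :: "nat \<Rightarrow> real"
    have "(\<Sum>i<dim_row B. \<Sum>j<dim_row B. c i * c j * B $$ (i, j)) =
          (\<Sum>i<n. \<Sum>j<n. c (e' (e i)) * c (e' (e j)) * M (e i) (e j))"
      by (intro sum.cong) (auto simp: B_def e'e)
    also have "\<dots> \<ge> 0"
      using psd[of "\<lambda>x. c (e' x)"] by (subst (asm) transfer)
    finally show "(\<Sum>i<dim_row B. \<Sum>j<dim_row B. c i * c j * B $$ (i, j)) \<ge> 0" .
  qed
  moreover have "completion_of B A"
    by (auto simp: completion_of_def A_def B_def split: if_splits)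
  ultimately have "partial_pos_semidef_mat A"
    by (auto simp: partial_pos_semidef_mat_def A_def)
  moreover have "\<forall>i < dim_row A. \<forall>j < dim_col A. \<forall>x. A $$ (i, j) = Some x \<longrightarrow> x \<in> X"
    by (auto simp: A_def)
  ultimately have "partial_pos_semidef_mat (map_mat (map_option f) A)"
    using f unfolding partial_positivity_preserver_def by blast
  then obtain C where C: "completion_of C (map_mat (map_option f) A)" "pos_semidef_mat C"
    by (auto simp: partial_pos_semidef_mat_def)
  have dim: "dim_row C = n" "dim_col C = n"
    using C(1) by (auto simp: completion_of_def A_def)
  show ?thesis
  proof
    fix c :: "'a \<Rightarrow> real"
    have "0 \<le> (\<Sum>i<n. \<Sum>j<n. c (e i) * c (e j) * C $$ (i, j))"
      using C(2) dim by (auto simp: pos_semidef_mat_def)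
    also have "\<dots> = (\<Sum>i<n. \<Sum>j<n. c (e i) * c (e j) * C $$ (e' (e i), e' (e j)))"
      by (intro sum.cong) (auto simp: e'e)
    also have "\<dots> = (\<Sum>x\<in>I. \<Sum>y\<in>I. c x * c y * C $$ (e' x, e' y))"
      by (subst transfer) (rule refl)
    finally show "(\<Sum>x\<in>I. \<Sum>y\<in>I. c x * c y * C $$ (e' x, e' y)) \<ge> 0" .
  next
    fix x y assume xy: "x \<in> I" "y \<in> I" "M x y \<in> X"
    then have "map_mat (map_option f) A $$ (e' x, e' y) = Some (f (M x y))"
      by (simp add: A_def e')
    moreover have "e' x < n" "e' y < n" "dim_row A = n" "dim_col A = n"
      using xy e' by (auto simp: A_def)
    ultimately show "C $$ (e' x, e' y) = f (M x y)"
      using C(1) unfolding completion_of_def by auto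
  qed
qed

lemma prod_one_plus:
  fixes f :: "'a \<Rightarrow> 'b :: comm_semiring_1"
  assumes "finite A"
  shows "(\<Prod>x\<in>A. 1 + f x) = (\<Sum>B\<in>Pow A. \<Prod>x\<in>B. f x)"
  using prod_add[OF assms, of f "\<lambda>_. 1"] by (simp add: add.commute)

subsection \<open>Characters of the Boolean group\<close>

text \<open>Coordinate \<open>i\<close> of the vertex \<open>T\<close>: a vertex is encoded as the
  set of coordinates where it is -1, so that the group operation is symmetric difference. Sets of
  coordinates index the characters as well.\<close>

definition bsign :: "nat \<Rightarrow> nat set \<Rightarrow> real" where
  "bsign i T = (if i \<in> T then -1 else 1)"

definition walsh :: "nat set \<Rightarrow> nat set \<Rightarrow> real" where
  "walsh S T = (\<Prod>i\<in>S. bsign i T)"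

lemma bsign_sym_diff: "bsign i (sym_diff T U) = bsign i T * bsign i U"
  by (auto simp: bsign_def)

lemma bsign_squared [simp]: "bsign i T * bsign i T = 1"
  by (simp add: bsign_def)

lemma abs_bsign [simp]: "\<bar>bsign i T\<bar> = 1"
  by (simp add: bsign_def)

lemma abs_walsh [simp]: "\<bar>walsh S T\<bar> = 1"
  by (simp add: walsh_def abs_prod)

lemma walsh_sym_diff: "walsh S (sym_diff T U) = walsh S T * walsh S U"
  by (simp add: walsh_def bsign_sym_diff prod.distrib)

lemma walsh_union: "finite S \<Longrightarrow> finite S' \<Longrightarrow> S \<inter> S' = {} \<Longrightarrow> walsh (S \<union> S') T = walsh S T * walsh S' T"
  unfolding walsh_def by (rule prod.union_disjoint)

lemma sum_walsh:
  assumes "T \<subseteq> {..<d}"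
  shows "(\<Sum>S\<in>Pow {..<d}. walsh S T) = (if T = {} then 2 ^ d else 0)"
proof -
  have "(\<Sum>S\<in>Pow {..<d}. walsh S T) = (\<Prod>i<d. 1 + bsign i T)"
    by (simp add: prod_one_plus walsh_def)
  also have "\<dots> = (if T = {} then 2 ^ d else 0)"
  proof (cases "T = {}")
    case False
    then obtain i where "i \<in> T" "i < d" using assms by auto
    then show ?thesis using False by (auto simp: bsign_def)
  qed (simp add: bsign_def)
  finally show ?thesis .
qed

lemma sum_bsign:
  assumes "T \<subseteq> {..<d}"
  shows "(\<Sum>i<d. bsign i T) = real d - 2 * real (card T)"
proof -
  have "(\<Sum>i<d. bsign i T) = (\<Sum>i<d. 1 - 2 * indicator T i)"
    by (intro sum.cong) (auto simp: bsign_def)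
  also have "\<dots> = real d - 2 * (\<Sum>i<d. indicator T i)"
    by (simp add: sum_subtractf sum_distrib_left)
  also have "(\<Sum>i<d. indicator T i :: real) = card T"
    using assms by (simp add: indicator_def sum.If_cases Int_absorb1)
  finally show ?thesis .
qed

text \<open>Averaging \<open>K\<close> over all translations leaves a function on the group. Its
  Fourier coefficient at \<open>S\<close> is, up to scaling, the quadratic form of \<open>K\<close>
  at the character of \<open>S\<close>, hence nonnegative. A value that is constant along a
  translation orbit survives the averaging.\<close>

lemma positive_semidefinite_expansion:
  fixes K :: "nat set \<Rightarrow> nat set \<Rightarrow> real"
  assumes psd: "\<And>c. (\<Sum>x\<in>Pow {..<d}. \<Sum>y\<in>Pow {..<d}. c x * c y * K x y) \<ge> 0"
  obtains b :: "nat set \<Rightarrow> real" where "\<And>S. b S \<ge> 0"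
    and "\<And>z v. z \<subseteq> {..<d} \<Longrightarrow> (\<And>x. x \<subseteq> {..<d} \<Longrightarrow> K x (sym_diff x z) = v) \<Longrightarrow>
            (\<Sum>S\<in>Pow {..<d}. b S * walsh S z) = v"
proof
  let ?G = "Pow {..<d}"
  let ?b = "\<lambda>S. (\<Sum>x\<in>?G. \<Sum>y\<in>?G. walsh S x * walsh S y * K x y) / (2 ^ d * 2 ^ d)"
  show "?b S \<ge> 0" for S
    using psd[of "walsh S"] by simp
  fix z v assume z: "z \<subseteq> {..<d}" and v: "\<And>x. x \<subseteq> {..<d} \<Longrightarrow> K x (sym_diff x z) = v"
  have "(\<Sum>S\<in>?G. ?b S * walsh S z) * (2 ^ d * 2 ^ d) =
        (\<Sum>S\<in>?G. \<Sum>x\<in>?G. \<Sum>y\<in>?G. walsh S x * walsh S y * K x y * walsh S z)"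
    by (simp add: sum_distrib_right sum_divide_distrib)
  also have "\<dots> = (\<Sum>x\<in>?G. \<Sum>y\<in>?G. \<Sum>S\<in>?G. walsh S x * walsh S y * K x y * walsh S z)"
    by (rule trans[OF sum.swap]) (intro sum.cong refl sum.swap)
  also have "\<dots> = (\<Sum>x\<in>?G. \<Sum>y\<in>?G. K x y * (\<Sum>S\<in>?G. walsh S (sym_diff y (sym_diff x z))))"
    by (simp add: walsh_sym_diff sum_distrib_left mult_ac)
  \<comment> \<open>Orthogonality of characters: the sum over \<open>S\<close> vanishes unless the
    argument is the neutral element.\<close>
  also have "\<dots> = (\<Sum>x\<in>?G. \<Sum>y\<in>?G. if y = sym_diff x z then 2 ^ d * K x y else 0)"
  proof (intro sum.cong refl)
    fix x y assume xy: "x \<in> ?G" "y \<in> ?G"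
    have "sym_diff y (sym_diff x z) \<subseteq> {..<d}" using xy z by auto
    moreover have "sym_diff y (sym_diff x z) = {} \<longleftrightarrow> y = sym_diff x z" by blast
    ultimately show "K x y * (\<Sum>S\<in>?G. walsh S (sym_diff y (sym_diff x z))) =
        (if y = sym_diff x z then 2 ^ d * K x y else 0)"
      by (simp only: sum_walsh) simp
  qed
  also have "\<dots> = (\<Sum>x\<in>?G. 2 ^ d * v)"
  proof (intro sum.cong refl)
    fix x assume x: "x \<in> ?G"
    then have "sym_diff x z \<in> ?G" using z by auto
    then show "(\<Sum>y\<in>?G. if y = sym_diff x z then 2 ^ d * K x y else 0) = 2 ^ d * v"
      using x v by (subst sum.delta) auto
  qed
  also have "\<dots> = v * (2 ^ d * 2 ^ d)" by (simp add: card_Pow)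
  finally show "(\<Sum>S\<in>?G. ?b S * walsh S z) = v" by (simp only: mult_cancel_right) simp
qed

subsection \<open>Krawtchouk averages\<close>

definition level :: "nat \<Rightarrow> nat \<Rightarrow> nat set set" where
  "level d h = {T. T \<subseteq> {..<d} \<and> card T = h}"

lemma finite_level [simp]: "finite (level d h)"
  by (rule finite_subset[of _ "Pow {..<d}"]) (auto simp: level_def)

lemma card_level [simp]: "card (level d h) = d choose h"
  using n_subsets[of "{..<d}" h] by (simp add: level_def)

text \<open>The average of a character of degree \<open>k\<close> over the sets of size \<open>h\<close>: expand the character
  as \<open>\<Prod>(1 - 2[i \<in> T])\<close> and use the probability that a random set of size \<open>h\<close> contains \<open>u\<close> given
  points. The product vanishes automatically for \<open>u > h\<close>.\<close>
definition kraw :: "nat \<Rightarrow> nat \<Rightarrow> nat \<Rightarrow> real" where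
  "kraw d h k =
     (\<Sum>u\<le>k. real (k choose u) * ((-2) ^ u * (\<Prod>i<u. (real h - real i) / (real d - real i))))"

lemma binomial_diff_both:
  assumes "u \<le> h" "h \<le> d"
  shows "real ((d - u) choose (h - u)) =
           real (d choose h) * (\<Prod>i<u. (real h - real i) / (real d - real i))"
  using assms
proof (induction u)
  case (Suc u)
  have "(h - u) * ((d - u) choose (h - u)) = (d - u) * ((d - u - 1) choose (h - u - 1))"
    using Suc.prems by (intro times_binomial_minus1_eq) auto
  then have "real (h - u) * real ((d - u) choose (h - u)) =
             real (d - u) * real ((d - Suc u) choose (h - Suc u))"
    by (metis Suc_eq_plus1 diff_diff_left of_nat_mult)
  moreover have "real d - real u > 0" "real (h - u) = real h - real u" "real (d - u) = real d - real u"
    using Suc.prems by auto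
  ultimately have "real ((d - Suc u) choose (h - Suc u)) =
      real ((d - u) choose (h - u)) * ((real h - real u) / (real d - real u))"
    by (simp add: field_simps)
  then show ?case using Suc by simp
qed simp

lemma card_level_supersets:
  assumes U: "U \<subseteq> {..<d}" and h: "h \<le> d"
  shows "real (card {T \<in> level d h. U \<subseteq> T}) =
           real (d choose h) * (\<Prod>i<card U. (real h - real i) / (real d - real i))"
proof (cases "card U \<le> h")
  case True
  have fU: "finite U" using U finite_subset by blast
  have "bij_betw (\<lambda>B. B \<union> U) {B. B \<subseteq> {..<d} - U \<and> card B = h - card U} {T \<in> level d h. U \<subseteq> T}"
  proof (rule bij_betwI[where g = "\<lambda>T. T - U"], goal_cases)
    case 1
    show ?case
    proof
      fix B assume "B \<in> {B. B \<subseteq> {..<d} - U \<and> card B = h - card U}"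
      then have B: "B \<subseteq> {..<d} - U" "card B = h - card U" by auto
      then have "card (B \<union> U) = card B + card U"
        using fU finite_subset[OF B(1)] by (intro card_Un_disjoint) auto
      then show "B \<union> U \<in> {T \<in> level d h. U \<subseteq> T}"
        using B U True by (auto simp: level_def)
    qed
  next
    case 2
    show ?case using fU by (auto simp: level_def card_Diff_subset)
  qed (auto simp: level_def)
  then have "card {T \<in> level d h. U \<subseteq> T} = card {B. B \<subseteq> {..<d} - U \<and> card B = h - card U}"
    by (simp add: bij_betw_same_card)
  also have "\<dots> = (d - card U) choose (h - card U)"
    using U fU by (subst n_subsets) (auto simp: card_Diff_subset)
  finally show ?thesis using binomial_diff_both[OF True h] by simp
next
  case False
  have "{T \<in> level d h. U \<subseteq> T} = {}"
    using False by (auto simp: level_def dest: card_mono[OF finite_subset[OF _ finite_lessThan]])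
  moreover have "(\<Prod>i<card U. (real h - real i) / (real d - real i)) = 0"
    using False by (intro prod_zero) auto
  ultimately show ?thesis by (simp del: prod_zero_iff)
qed

lemma sum_Pow_card:
  fixes F :: "nat \<Rightarrow> real"
  assumes "finite S"
  shows "(\<Sum>U\<in>Pow S. F (card U)) = (\<Sum>u\<le>card S. real (card S choose u) * F u)"
proof -
  have "(\<Sum>U\<in>Pow S. F (card U)) = (\<Sum>u\<le>card S. \<Sum>U\<in>{U \<in> Pow S. card U = u}. F (card U))"
    using assms by (intro sum.group[symmetric]) (auto intro: card_mono)
  also have "\<dots> = (\<Sum>u\<le>card S. real (card S choose u) * F u)"
    using n_subsets[OF assms] by (intro sum.cong) (auto simp: Pow_def)
  finally show ?thesis .
qed

text \<open>The average depends on \<open>S\<close> only through its size, which later allows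
  coefficients to be grouped by degree.\<close>

lemma sum_walsh_level:
  assumes S: "S \<subseteq> {..<d}" and h: "h \<le> d"
  shows "(\<Sum>T\<in>level d h. walsh S T) = real (d choose h) * kraw d h (card S)"
proof -
  have fS: "finite S" using S finite_subset by blast
  define q where "q u = (\<Prod>i<u. (real h - real i) / (real d - real i))" for u
  have walsh: "walsh S T = (\<Sum>U\<in>Pow S. if U \<subseteq> T then (-2) ^ card U else 0)" for T
  proof -
    have "walsh S T = (\<Prod>i\<in>S. 1 + (if i \<in> T then -2 else 0))"
      unfolding walsh_def by (intro prod.cong) (auto simp: bsign_def)
    also have "\<dots> = (\<Sum>U\<in>Pow S. \<Prod>i\<in>U. if i \<in> T then -2 else 0)"
      by (rule prod_one_plus[OF fS])
    also have "\<dots> = (\<Sum>U\<in>Pow S. if U \<subseteq> T then (-2) ^ card U else 0)"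
    proof (intro sum.cong refl)
      fix U assume "U \<in> Pow S"
      then have "finite U" using fS finite_subset by auto
      show "(\<Prod>i\<in>U. if i \<in> T then -2 else (0::real)) = (if U \<subseteq> T then (-2) ^ card U else 0)"
      proof (cases "U \<subseteq> T")
        case True
        then have "(\<Prod>i\<in>U. if i \<in> T then -2 else (0::real)) = (\<Prod>i\<in>U. -2)"
          by (intro prod.cong) auto
        then show ?thesis using True by simp
      next
        case False
        then show ?thesis using \<open>finite U\<close> by (auto intro!: prod_zero)
      qed
    qed
    finally show ?thesis .
  qed
  have "(\<Sum>T\<in>level d h. walsh S T) =
        (\<Sum>U\<in>Pow S. \<Sum>T\<in>level d h. if U \<subseteq> T then (-2) ^ card U else 0)"
    unfolding walsh by (rule sum.swap)
  also have "\<dots> = (\<Sum>U\<in>Pow S. real (d choose h) * ((-2) ^ card U * q (card U)))"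
  proof (intro sum.cong refl)
    fix U assume "U \<in> Pow S"
    then have "U \<subseteq> {..<d}" using S by auto
    have "(\<Sum>T\<in>level d h. if U \<subseteq> T then (-2) ^ card U else 0) =
          real (card {T \<in> level d h. U \<subseteq> T}) * (-2) ^ card U"
      by (simp add: sum.If_cases Int_def)
    then show "(\<Sum>T\<in>level d h. if U \<subseteq> T then (-2) ^ card U else 0) =
          real (d choose h) * ((-2) ^ card U * q (card U))"
      unfolding card_level_supersets[OF \<open>U \<subseteq> {..<d}\<close> h] q_def by simp
  qed
  also have "\<dots> = real (d choose h) * kraw d h (card S)"
    unfolding kraw_def q_def[symmetric] sum_distrib_left[symmetric]
    by (subst sum_Pow_card[OF fS]) (rule refl)
  finally show ?thesis .
qed

text \<open>For a fixed degree the number of terms is fixed, and each factor has the same limit as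
  \<open>h / d\<close>: sampling without replacement turns into independent sampling. The limiting
  sum is a binomial expansion.\<close>

lemma kraw_tendsto:
  assumes d: "filterlim d at_top F" and p: "((\<lambda>j. real (h j) / real (d j)) \<longlongrightarrow> p) F"
  shows "((\<lambda>j. kraw (d j) (h j) k) \<longlongrightarrow> (1 - 2 * p) ^ k) F"
proof -
  have dr: "filterlim (\<lambda>j. real (d j)) at_top F"
    using d by (rule filterlim_compose[OF filterlim_real_sequentially])
  have "((\<lambda>j. (real (h j) - real i) / (real (d j) - real i)) \<longlongrightarrow> p) F" for i
  proof -
    have i: "((\<lambda>j. real i / real (d j)) \<longlongrightarrow> 0) F"
      by (rule real_tendsto_divide_at_top[OF tendsto_const dr])
    have "((\<lambda>j. (real (h j) / real (d j) - real i / real (d j)) / (1 - real i / real (d j))) \<longlongrightarrow>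
            (p - 0) / (1 - 0)) F"
      by (intro tendsto_divide tendsto_diff p i tendsto_const) simp
    moreover have "\<forall>\<^sub>F j in F. (real (h j) / real (d j) - real i / real (d j)) / (1 - real i / real (d j)) =
        (real (h j) - real i) / (real (d j) - real i)"
      using filterlim_at_top_dense[THEN iffD1, OF dr, rule_format, of "real i"]
      by eventually_elim (auto simp: divide_simps)
    ultimately show ?thesis by (auto elim: Lim_transform_eventually)
  qed
  then have "((\<lambda>j. kraw (d j) (h j) k) \<longlongrightarrow> (\<Sum>u\<le>k. real (k choose u) * ((-2) ^ u * (\<Prod>i<u. p)))) F"
    unfolding kraw_def by (intro tendsto_intros)
  also have "(\<Sum>u\<le>k. real (k choose u) * ((-2) ^ u * (\<Prod>i<u. p))) = (1 - 2 * p) ^ k"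
    using binomial_ring[of "-2 * p" 1 k] by (simp add: power_mult_distrib[symmetric])
  finally show ?thesis .
qed

section \<open>Tail bound in the degree, and reflection of degrees\<close>

lemma bsign_image_transpose:
  "bsign i (Transposition.transpose s t ` T) = bsign (Transposition.transpose s t i) T"
proof -
  have "i \<in> Transposition.transpose s t ` T \<longleftrightarrow> Transposition.transpose s t i \<in> T"
    by (metis image_iff transpose_involutory)
  then show ?thesis by (simp add: bsign_def)
qed

lemma bij_betw_level_transpose:
  assumes "s < d" "t < d"
  shows "bij_betw ((`) (Transposition.transpose s t)) (level d h) (level d h)"
proof (rule bij_betwI[where g = "(`) (Transposition.transpose s t)"])
  have "Transposition.transpose s t ` T \<in> level d h" if "T \<in> level d h" for T
  proof -
    have "inj_on (Transposition.transpose s t) T"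
      by (metis inj_onI transpose_involutory)
    then have "card (Transposition.transpose s t ` T) = card T"
      by (rule card_image)
    then show ?thesis
      using that assms by (auto simp: level_def Transposition.transpose_def split: if_splits)
  qed
  then show "(`) (Transposition.transpose s t) \<in> level d h \<rightarrow> level d h"
    "(`) (Transposition.transpose s t) \<in> level d h \<rightarrow> level d h" by auto
qed (simp_all add: image_image)

text \<open>Swapping \<open>i\<close> and \<open>k + i\<close> changes the sign of the character on the sets that contain exactly one of
  them, so only the sets that separate none of these pairs contribute.\<close>
lemma sum_walsh_level_pairs:
  assumes "m \<le> k" "k + m \<le> d"
  shows "(\<Sum>T\<in>level d h. walsh {..<k} T) =
    (\<Sum>T\<in>level d h. walsh {..<k} T * (\<Prod>i<m. (1 + bsign i T * bsign (k + i) T) / 2))"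
  using assms
proof (induction m)
  case (Suc m)
  define R where "R T = (\<Prod>i<m. (1 + bsign i T * bsign (k + i) T) / 2)" for T
  \<comment> \<open>The part of the summand that the new factor for the pair \<open>m\<close>,
    \<open>k + m\<close> removes, rewritten with \<open>bsign m T\<close> squared equal to 1.
    Swapping the pair negates it, because the remaining factors involve neither index.\<close>
  define F where "F T = (bsign m T - bsign (k + m) T) / 2 * walsh ({..<k} - {m}) T * R T" for T
  define \<tau> where "\<tau> = Transposition.transpose m (k + m)"
  have walsh: "walsh {..<k} T = bsign m T * walsh ({..<k} - {m}) T" for T
    unfolding walsh_def using Suc.prems by (intro prod.remove) auto
  have "F (\<tau> ` T) = - F T" for T
  proof -
    have "walsh ({..<k} - {m}) (\<tau> ` T) = walsh ({..<k} - {m}) T"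
      unfolding walsh_def \<tau>_def bsign_image_transpose
      by (intro prod.cong) (auto simp: Transposition.transpose_def)
    moreover have "R (\<tau> ` T) = R T"
      unfolding R_def \<tau>_def bsign_image_transpose using Suc.prems
      by (intro prod.cong) (auto simp: Transposition.transpose_def)
    ultimately show ?thesis
      by (simp add: F_def \<tau>_def bsign_image_transpose field_simps)
  qed
  then have "(\<Sum>T\<in>level d h. F T) = - (\<Sum>T\<in>level d h. F T)"
    using sum.reindex_bij_betw[OF bij_betw_level_transpose, of m d "k + m" F h] Suc.prems
    by (simp add: \<tau>_def sum_negf)
  then have "0 = (\<Sum>T\<in>level d h. F T)" by simp
  also have "\<dots> = (\<Sum>T\<in>level d h. walsh {..<k} T * R T -
       walsh {..<k} T * (R T * ((1 + bsign m T * bsign (k + m) T) / 2)))"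
    by (intro sum.cong refl) (auto simp: F_def walsh bsign_def)
  finally show ?case
    using Suc by (simp add: sum_subtractf R_def)
qed simp

text \<open>Characters have absolute value 1, so the average is at most the proportion of sets that
  separate none of the \<open>m\<close> pairs. Expanding that indicator leaves only averages of even
  degree at most \<open>2 * m\<close>; the bound is thus independent of \<open>k\<close> and has a
  limit for fixed \<open>m\<close>.\<close>

lemma abs_kraw_le:
  assumes mk: "m \<le> k" "k + m \<le> d" and h: "h \<le> d"
  shows "\<bar>kraw d h k\<bar> \<le> (\<Sum>l\<le>m. real (m choose l) * kraw d h (2 * l)) / 2 ^ m"
proof -
  define u where "u i T = (1 + bsign i T * bsign (k + i) T) / 2" for i T
  have u: "u i T \<ge> 0" for i T by (auto simp: u_def bsign_def)
  have C: "real (d choose h) > 0" using h by simp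
  have "real (d choose h) * \<bar>kraw d h k\<bar> = \<bar>\<Sum>T\<in>level d h. walsh {..<k} T\<bar>"
    using mk h by (subst sum_walsh_level) (auto simp: abs_mult)
  also have "\<dots> = \<bar>\<Sum>T\<in>level d h. walsh {..<k} T * (\<Prod>i<m. u i T)\<bar>"
    unfolding u_def using sum_walsh_level_pairs[OF mk] by simp
  also have "\<dots> \<le> (\<Sum>T\<in>level d h. \<bar>walsh {..<k} T * (\<Prod>i<m. u i T)\<bar>)"
    by (rule sum_abs)
  also have "\<dots> = (\<Sum>T\<in>level d h. \<Prod>i<m. u i T)"
    using u by (simp add: abs_mult abs_prod)
  \<comment> \<open>A choice \<open>J\<close> of pairs contributes the character of all their
    members; these are distinct because \<open>m \<le> k\<close>.\<close>
  also have "\<dots> = (\<Sum>T\<in>level d h. \<Sum>J\<in>Pow {..<m}. walsh (J \<union> (+) k ` J) T) / 2 ^ m"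
  proof (subst sum_divide_distrib, intro sum.cong refl)
    fix T
    have "(\<Prod>i<m. 1 + bsign i T * bsign (k + i) T) =
        (\<Sum>J\<in>Pow {..<m}. \<Prod>i\<in>J. bsign i T * bsign (k + i) T)"
      by (rule prod_one_plus) simp
    also have "\<dots> = (\<Sum>J\<in>Pow {..<m}. walsh (J \<union> (+) k ` J) T)"
    proof (intro sum.cong refl)
      fix J assume "J \<in> Pow {..<m}"
      then have "finite J" "J \<inter> (+) k ` J = {}" using mk finite_subset[of J "{..<m}"] by auto
      then show "(\<Prod>i\<in>J. bsign i T * bsign (k + i) T) = walsh (J \<union> (+) k ` J) T"
        by (subst walsh_union) (auto simp: walsh_def prod.distrib prod.reindex)
    qed
    finally show "(\<Prod>i<m. u i T) = (\<Sum>J\<in>Pow {..<m}. walsh (J \<union> (+) k ` J) T) / 2 ^ m"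
      by (simp add: u_def prod_dividef)
  qed
  also have "(\<Sum>T\<in>level d h. \<Sum>J\<in>Pow {..<m}. walsh (J \<union> (+) k ` J) T) =
      (\<Sum>J\<in>Pow {..<m}. \<Sum>T\<in>level d h. walsh (J \<union> (+) k ` J) T)"
    by (rule sum.swap)
  also have "\<dots> = (\<Sum>J\<in>Pow {..<m}. real (d choose h) * kraw d h (2 * card J))"
  proof (intro sum.cong refl)
    fix J assume "J \<in> Pow {..<m}"
    then have J: "J \<subseteq> {..<m}" "finite J" "J \<inter> (+) k ` J = {}"
      using mk finite_subset[of J "{..<m}"] by auto
    then have "card (J \<union> (+) k ` J) = 2 * card J"
      by (subst card_Un_disjoint) (auto simp: card_image)
    moreover have "J \<union> (+) k ` J \<subseteq> {..<d}" using J(1) mk by auto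
    ultimately show "(\<Sum>T\<in>level d h. walsh (J \<union> (+) k ` J) T) = real (d choose h) * kraw d h (2 * card J)"
      using h by (simp add: sum_walsh_level)
  qed
  also have "\<dots> = real (d choose h) * (\<Sum>l\<le>m. real (m choose l) * kraw d h (2 * l))"
    using sum_Pow_card[of "{..<m}" "\<lambda>u. kraw d h (2 * u)"] by (simp add: sum_distrib_left[symmetric])
  finally have "real (d choose h) * \<bar>kraw d h k\<bar> \<le>
      real (d choose h) * ((\<Sum>l\<le>m. real (m choose l) * kraw d h (2 * l)) / 2 ^ m)"
    by simp
  then show ?thesis using C by (rule mult_left_le_imp_le)
qed

text \<open>Characters of complementary sets multiply to the parity sign of \<open>T\<close>, which
  is 1 for even \<open>h\<close>. This is why \<open>D\<close> is later taken even.\<close>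

lemma kraw_reflect:
  assumes k: "k \<le> d" and h: "h \<le> d" "even h"
  shows "kraw d h (d - k) = kraw d h k"
proof -
  have "real (d choose h) * kraw d h (d - k) = (\<Sum>T\<in>level d h. walsh {k..<d} T)"
    using h by (subst sum_walsh_level) auto
  also have "\<dots> = (\<Sum>T\<in>level d h. walsh {..<k} T)"
  proof (intro sum.cong refl)
    fix T assume T: "T \<in> level d h"
    have "walsh {..<k} T * walsh {k..<d} T = walsh {..<d} T"
      using k by (subst walsh_union[symmetric]) (auto intro: arg_cong2[where f = walsh])
    also have "\<dots> = (\<Prod>i<d. if i \<in> T then -1 else 1)"
      by (simp add: walsh_def bsign_def)
    also have "\<dots> = (-1) ^ card T"
      using T by (simp add: level_def prod.If_cases Int_absorb1)
    also have "\<dots> = 1" using T h by (simp add: level_def)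
    finally have "walsh {..<k} T * walsh {k..<d} T = 1" .
    moreover have "walsh {..<k} T = 1 \<or> walsh {..<k} T = -1"
      using abs_walsh[of "{..<k}" T] by linarith
    ultimately show "walsh {k..<d} T = walsh {..<k} T" by auto
  qed
  also have "\<dots> = real (d choose h) * kraw d h k"
    using k h by (subst sum_walsh_level) auto
  finally show ?thesis using h by simp
qed

subsection \<open>Expansion on the cube\<close>

lemma cube_expansion:
  assumes \<psi>: "partial_positivity_preserver \<int> \<psi>" and N: "N > 0" and D: "D > 0"
  defines "d \<equiv> 2 * N * D"
  obtains b :: "nat set \<Rightarrow> real" where "\<And>S. b S \<ge> 0"
    and "\<And>t. t \<le> 2 * N \<Longrightarrow>
            (\<Sum>S\<in>Pow {..<d}. b S * kraw d (t * D) (card S)) = \<psi> (real N - real t)"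
proof -
  let ?G = "Pow {..<d}"
  \<comment> \<open>The scaling puts \<open>N\<close> on the diagonal, and since
    \<open>d = 2 * N * D\<close>, flipping \<open>D\<close> coordinates lowers the entry by exactly
    1.\<close>
  define M where "M x y = real N / real d * (\<Sum>i<d. bsign i x * bsign i y)" for x y
  have M_psd: "(\<Sum>x\<in>?G. \<Sum>y\<in>?G. c x * c y * M x y) \<ge> 0" for c
  proof -
    have "(\<Sum>x\<in>?G. \<Sum>y\<in>?G. c x * c y * M x y) =
        real N / real d * (\<Sum>x\<in>?G. \<Sum>y\<in>?G. \<Sum>i<d. (c x * bsign i x) * (c y * bsign i y))"
      by (simp add: M_def sum_distrib_left mult_ac)
    also have "(\<Sum>x\<in>?G. \<Sum>y\<in>?G. \<Sum>i<d. (c x * bsign i x) * (c y * bsign i y)) =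
        (\<Sum>x\<in>?G. \<Sum>i<d. \<Sum>y\<in>?G. (c x * bsign i x) * (c y * bsign i y))"
      by (intro sum.cong refl sum.swap)
    also have "\<dots> = (\<Sum>i<d. \<Sum>x\<in>?G. \<Sum>y\<in>?G. (c x * bsign i x) * (c y * bsign i y))"
      by (rule sum.swap)
    also have "\<dots> = (\<Sum>i<d. (\<Sum>x\<in>?G. c x * bsign i x) ^ 2)"
      by (simp add: sum_product power2_eq_square)
    finally show ?thesis by (simp add: sum_nonneg)
  qed
  have M_sym_diff: "M x (sym_diff x z) = real N - real t"
    if "z \<in> level d (t * D)" for x z t
  proof -
    have z: "z \<subseteq> {..<d}" "card z = t * D" using that by (auto simp: level_def)
    have "(\<Sum>i<d. bsign i x * bsign i (sym_diff x z)) = (\<Sum>i<d. bsign i z)"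
      by (simp add: bsign_sym_diff mult.assoc[symmetric])
    also have "\<dots> = 2 * real D * (real N - real t)"
      unfolding sum_bsign[OF z(1)] z(2) by (simp add: d_def algebra_simps)
    finally show ?thesis using N D by (simp add: M_def d_def)
  qed
  obtain K where K_psd: "\<And>c. (\<Sum>x\<in>?G. \<Sum>y\<in>?G. c x * c y * K x y) \<ge> 0"
    and K: "\<And>x y. x \<in> ?G \<Longrightarrow> y \<in> ?G \<Longrightarrow> M x y \<in> \<int> \<Longrightarrow> K x y = \<psi> (M x y)"
    using partial_positivity_preserver_kernel[OF \<psi>, of ?G M] M_psd
    by (auto simp: M_def mult.commute)
  obtain b where b0: "\<And>S. b S \<ge> 0"
    and b: "\<And>z v. z \<subseteq> {..<d} \<Longrightarrow> (\<And>x. x \<subseteq> {..<d} \<Longrightarrow> K x (sym_diff x z) = v) \<Longrightarrow>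
            (\<Sum>S\<in>?G. b S * walsh S z) = v"
    using positive_semidefinite_expansion[OF K_psd] by blast
  show ?thesis
  proof (rule that[of b])
    show "b S \<ge> 0" for S by (rule b0)
    fix t assume t: "t \<le> 2 * N"
    have h: "t * D \<le> d" using t by (simp add: d_def)
    \<comment> \<open>Summing over all points of weight \<open>t * D\<close> replaces each character
      by its average; every such point gives the same value of \<psi>.\<close>
    have "real (d choose (t * D)) * \<psi> (real N - real t) =
        (\<Sum>z\<in>level d (t * D). \<Sum>S\<in>?G. b S * walsh S z)"
    proof -
      have "(\<Sum>S\<in>?G. b S * walsh S z) = \<psi> (real N - real t)" if z: "z \<in> level d (t * D)" for z
      proof (rule b)
        show zd: "z \<subseteq> {..<d}" using z by (simp add: level_def)
        fix x assume "x \<subseteq> {..<d}"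
        then show "K x (sym_diff x z) = \<psi> (real N - real t)"
          using zd M_sym_diff[OF z, of x] by (subst K) auto
      qed
      then show ?thesis by simp
    qed
    also have "\<dots> = (\<Sum>S\<in>?G. b S * (\<Sum>z\<in>level d (t * D). walsh S z))"
      by (subst sum.swap) (simp add: sum_distrib_left)
    also have "\<dots> = real (d choose (t * D)) * (\<Sum>S\<in>?G. b S * kraw d (t * D) (card S))"
      using h by (simp add: sum_walsh_level sum_distrib_left mult_ac)
    finally show "(\<Sum>S\<in>?G. b S * kraw d (t * D) (card S)) = \<psi> (real N - real t)"
      using h by simp
  qed
qed

text \<open>Groups the expansion by degree. The total mass of the coefficients is the value of
  \<psi> at \<open>N\<close>, which bounds both each \<open>c k\<close> and the tail. One
  \<open>c\<close> serves all \<open>t\<close> and \<open>m\<close>, so that a limit of such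
  sequences can serve them too.\<close>

lemma truncated_cube_expansion:
  assumes \<psi>: "partial_positivity_preserver \<int> \<psi>" and N: "N > 0" and D: "D > 0" "even D"
  defines "d \<equiv> 2 * N * D"
  shows "\<exists>c :: nat \<Rightarrow> real. (\<forall>k. 0 \<le> c k \<and> c k \<le> \<psi> (real N)) \<and> (\<forall>t m. t \<le> 2 * N \<longrightarrow> m \<le> D \<longrightarrow>
      \<bar>\<psi> (real N - real t) - (\<Sum>k<m. c k * kraw d (t * D) k)\<bar> \<le>
        \<psi> (real N) * ((\<Sum>l\<le>m. real (m choose l) * kraw d (t * D) (2 * l)) / 2 ^ m))"
proof -
  let ?G = "Pow {..<d}"
  obtain b :: "nat set \<Rightarrow> real" where b0: "\<And>S. b S \<ge> 0" and b: "\<And>t. t \<le> 2 * N \<Longrightarrow>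
            (\<Sum>S\<in>?G. b S * kraw d (t * D) (card S)) = \<psi> (real N - real t)"
    using cube_expansion[OF \<psi> N D(1)] unfolding d_def by blast
  \<comment> \<open>The case \<open>t = 0\<close> of the expansion then yields the total mass; for
    \<open>u > 0\<close> the product contains the zero factor at \<open>i = 0\<close>.\<close>
  have "kraw d 0 k = 1" for k
  proof -
    have "kraw d 0 k = (\<Sum>u\<in>{0}. real (k choose u) * ((-2) ^ u * (\<Prod>i<u. (real 0 - real i) / (real d - real i))))"
      unfolding kraw_def by (intro sum.mono_neutral_right) auto
    then show ?thesis by simp
  qed
  then have sum_b: "(\<Sum>S\<in>?G. b S) = \<psi> (real N)"
    using b[of 0] by simp
  \<comment> \<open>Degrees above \<open>d - m\<close> escape the tail bound; for sets of even size they have the same averages as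
    the reflected degrees below \<open>m\<close>.\<close>
  define c where "c k = (\<Sum>S\<in>?G. if card S = k \<or> card S = d - k then b S else 0)" for k
  show ?thesis
  proof (intro exI[of _ c] conjI allI impI)
    fix k
    show "0 \<le> c k" unfolding c_def using b0 by (intro sum_nonneg) auto
    show "c k \<le> \<psi> (real N)" unfolding c_def sum_b[symmetric] using b0 by (intro sum_mono) auto
  next
    fix t m assume t: "t \<le> 2 * N" and m: "m \<le> D"
    define \<kappa> where "\<kappa> = kraw d (t * D)"
    define \<tau> where "\<tau> = (\<Sum>l\<le>m. real (m choose l) * \<kappa> (2 * l)) / 2 ^ m"
    have h: "t * D \<le> d" "even (t * D)" using t D by (auto simp: d_def)
    have "D \<le> N * D" using N by simp
    then have md: "2 * m \<le> d" using m unfolding d_def by linarith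
    have tail: "\<bar>\<kappa> k\<bar> \<le> \<tau>" if "m \<le> k" "k + m \<le> d" for k
      unfolding \<kappa>_def \<tau>_def by (rule abs_kraw_le[OF that h(1)])
    have \<tau>0: "\<tau> \<ge> 0" using tail[of m] md by linarith
    \<comment> \<open>Since \<open>2 * m \<le> d\<close>, the degrees below \<open>m\<close> and
      their reflections do not overlap: each size outside the middle range is met exactly once, and
      sizes in the middle range never.\<close>
    have inner: "(\<Sum>k<m. if s = k \<or> s = d - k then \<kappa> k else 0) =
        (if m \<le> s \<and> s + m \<le> d then 0 else \<kappa> s)" if s: "s \<le> d" for s
    proof -
      consider "m \<le> s \<and> s + m \<le> d" | "s < m" | "s + m > d" by linarith
      then show ?thesis
      proof cases
        case 1
        then show ?thesis by (auto intro!: sum.neutral)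
      next
        case 2
        then have "(\<Sum>k<m. if s = k \<or> s = d - k then \<kappa> k else 0) = (\<Sum>k<m. if s = k then \<kappa> k else 0)"
          using md by (intro sum.cong) auto
        then show ?thesis using 2 by simp
      next
        case 3
        then have "(\<Sum>k<m. if s = k \<or> s = d - k then \<kappa> k else 0) = (\<Sum>k<m. if d - s = k then \<kappa> k else 0)"
          using md s by (intro sum.cong) auto
        also have "\<dots> = \<kappa> (d - s)"
        proof -
          have "d - s \<in> {..<m}" using 3 s md by auto
          then show ?thesis by (subst sum.delta') auto
        qed
        also have "\<dots> = \<kappa> s" unfolding \<kappa>_def by (rule kraw_reflect[OF s h])
        finally show ?thesis using 3 by simp
      qed
    qed
    have "(\<Sum>k<m. c k * \<kappa> k) =
        (\<Sum>k<m. \<Sum>S\<in>?G. b S * (if card S = k \<or> card S = d - k then \<kappa> k else 0))"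
      by (simp add: c_def sum_distrib_right if_distrib[of "\<lambda>x. x * _"] if_distrib[of "\<lambda>x. _ * x"] cong: if_cong)
    also have "\<dots> = (\<Sum>S\<in>?G. b S * (\<Sum>k<m. if card S = k \<or> card S = d - k then \<kappa> k else 0))"
      by (subst sum.swap) (simp add: sum_distrib_left)
    also have "\<dots> = (\<Sum>S\<in>?G. b S * (if m \<le> card S \<and> card S + m \<le> d then 0 else \<kappa> (card S)))"
    proof (intro sum.cong refl)
      fix S assume "S \<in> ?G"
      then have "card S \<le> d" using card_mono[of "{..<d}" S] by auto
      then show "b S * (\<Sum>k<m. if card S = k \<or> card S = d - k then \<kappa> k else 0) =
          b S * (if m \<le> card S \<and> card S + m \<le> d then 0 else \<kappa> (card S))"
        by (simp only: inner)
    qed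
    finally have "\<psi> (real N - real t) - (\<Sum>k<m. c k * \<kappa> k) =
        (\<Sum>S\<in>?G. b S * (if m \<le> card S \<and> card S + m \<le> d then \<kappa> (card S) else 0))"
      unfolding b[OF t, symmetric] \<kappa>_def[symmetric]
      by (simp add: sum_subtractf[symmetric] right_diff_distrib[symmetric] if_distrib cong: if_cong)
    also have "\<bar>\<dots>\<bar> \<le> (\<Sum>S\<in>?G. b S * \<tau>)"
      using b0 tail \<tau>0 by (intro order.trans[OF sum_abs] sum_mono) (auto simp: abs_mult intro!: mult_left_mono)
    also have "\<dots> = \<psi> (real N) * \<tau>" by (simp add: sum_distrib_right[symmetric] sum_b)
    finally show "\<bar>\<psi> (real N - real t) - (\<Sum>k<m. c k * kraw d (t * D) k)\<bar> \<le>
        \<psi> (real N) * ((\<Sum>l\<le>m. real (m choose l) * kraw d (t * D) (2 * l)) / 2 ^ m)"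
      by (simp add: \<kappa>_def \<tau>_def)
  qed
qed

subsection \<open>Passage to the limit\<close>

text \<open>Serves both limits, first in \<open>D\<close> and then in \<open>N\<close>.\<close>

lemma diagonal_convergent_subsequence:
  fixes a :: "nat \<Rightarrow> nat \<Rightarrow> real"
  assumes bdd: "\<And>k. Bseq (\<lambda>j. a j k)"
  obtains r l where "strict_mono r" "\<And>k. (\<lambda>j. a (r j) k) \<longlonglongrightarrow> l k"
proof -
  interpret subseqs "\<lambda>k s. convergent (\<lambda>j. a (s j) k)"
  proof
    fix k and s :: "nat \<Rightarrow> nat"
    obtain r' where "strict_mono r'" "monoseq (\<lambda>j. a (s (r' j)) k)"
      using seq_monosub[of "\<lambda>j. a (s j) k"] by blast
    then show "\<exists>r'. strict_mono r' \<and> convergent (\<lambda>j. a ((s \<circ> r') j) k)"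
      using Bseq_monoseq_convergent[OF Bseq_subseq[OF bdd[of k], of "s \<circ> r'"]] by auto
  qed
  have "convergent (\<lambda>j. a (diagseq j) k)" for k
  proof -
    have "convergent (\<lambda>j. a ((diagseq \<circ> ((+) (Suc k))) j) k)"
      by (rule diagseq_holds) (use convergent_subseq_convergent in \<open>force simp: o_def\<close>)
    then show ?thesis
      by (subst convergent_ignore_initial_segment[of _ "Suc k", symmetric]) (simp add: add.commute)
  qed
  then show ?thesis
    by (intro that[OF subseq_diagseq]) (rule convergent_LIMSEQ_iff[THEN iffD1])
qed

lemma sums_of_partial_sum_bound:
  fixes a :: "nat \<Rightarrow> real"
  assumes bound: "\<And>m. \<bar>y - (\<Sum>k<m. a k)\<bar> \<le> B * q ^ m" and q: "0 \<le> q" "q < 1"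
  shows "a sums y"
proof -
  have "(\<lambda>m. B * q ^ m) \<longlonglongrightarrow> B * 0"
    using q by (intro tendsto_intros LIMSEQ_realpow_zero) auto
  then have "(\<lambda>m. B * q ^ m) \<longlonglongrightarrow> 0" by simp
  then have "(\<lambda>m. y - (\<Sum>k<m. a k)) \<longlonglongrightarrow> 0"
    by (rule Lim_null_comparison[rotated]) (use bound in \<open>auto intro: always_eventually\<close>)
  then have "(\<lambda>m. y - (y - (\<Sum>k<m. a k))) \<longlonglongrightarrow> y - 0"
    by (intro tendsto_diff tendsto_const)
  then show ?thesis by (simp add: sums_def)
qed

text \<open>For fixed \<open>N\<close> the coefficients stay in a bounded interval, so a subsequence
  converges. With \<open>m\<close> fixed, truncated sums and error bounds converge as well, and the
  error becomes geometric with ratio \<open>((x / N)\<^sup>2 + 1) / 2\<close>. This ratio is below 1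
  exactly when |x| < N.\<close>

lemma sums_on_bounded_integers:
  assumes \<psi>: "partial_positivity_preserver \<int> \<psi>" and N: "N > 0"
  obtains b :: "nat \<Rightarrow> real" where "\<And>k. b k \<ge> 0"
    and "\<And>x. x \<in> \<int> \<Longrightarrow> \<bar>x\<bar> < real N \<Longrightarrow> (\<lambda>k. b k * x ^ k) sums \<psi> x"
proof -
  define D where "D j = 2 * Suc j" for j
  define d where "d j = 2 * N * D j" for j
  define approximates where "approximates j c \<longleftrightarrow> (\<forall>k. 0 \<le> c k \<and> c k \<le> \<psi> (real N)) \<and>
      (\<forall>t m. t \<le> 2 * N \<longrightarrow> m \<le> D j \<longrightarrow>
        \<bar>\<psi> (real N - real t) - (\<Sum>k<m. c k * kraw (d j) (t * D j) k)\<bar> \<le>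
          \<psi> (real N) * ((\<Sum>l\<le>m. real (m choose l) * kraw (d j) (t * D j) (2 * l)) / 2 ^ m))"
    for j c
  have "\<exists>c. approximates j c" for j
  proof -
    have D: "D j > 0" "even (D j)" by (auto simp: D_def)
    show ?thesis
      unfolding approximates_def d_def by (rule truncated_cube_expansion[OF \<psi> N D])
  qed
  then obtain c where "\<And>j. approximates j (c j)" by metis
  then have c: "\<And>j k. 0 \<le> c j k" "\<And>j k. c j k \<le> \<psi> (real N)"
    and approx: "\<And>j t m. t \<le> 2 * N \<Longrightarrow> m \<le> D j \<Longrightarrow>
      \<bar>\<psi> (real N - real t) - (\<Sum>k<m. c j k * kraw (d j) (t * D j) k)\<bar> \<le>
        \<psi> (real N) * ((\<Sum>l\<le>m. real (m choose l) * kraw (d j) (t * D j) (2 * l)) / 2 ^ m)"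
    unfolding approximates_def by blast+
  have "Bseq (\<lambda>j. c j k)" for k
    using c by (intro BseqI'[of _ "\<psi> (real N)"]) auto
  then obtain r l where r: "strict_mono r" and l: "\<And>k. (\<lambda>j. c (r j) k) \<longlonglongrightarrow> l k"
    using diagonal_convergent_subsequence[of c] by blast
  have l0: "l k \<ge> 0" for k
    using l[of k] c by (intro LIMSEQ_le_const) auto
  have r_inf: "filterlim r at_top sequentially"
    using r by (rule filterlim_subseq)
  have D_inf: "filterlim (\<lambda>j. D (r j)) at_top sequentially"
    by (rule filterlim_at_top_mono[OF r_inf]) (auto simp: D_def)
  have d_inf: "filterlim (\<lambda>j. d (r j)) at_top sequentially"
    by (rule filterlim_at_top_mono[OF D_inf]) (use N in \<open>auto simp: d_def\<close>)
  have bound: "\<bar>\<psi> (real N - real t) - (\<Sum>k<m. l k * (1 - real t / real N) ^ k)\<bar> \<le>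
      \<psi> (real N) * (((1 - real t / real N)\<^sup>2 + 1) / 2) ^ m" if t: "t \<le> 2 * N" for t m
  proof -
    have "real (t * D j) / real (d j) = real t / (2 * real N)" for j
    proof -
      have "D j > 0" by (simp add: D_def)
      then show ?thesis by (simp add: d_def)
    qed
    \<comment> \<open>The proportion of flipped coordinates is \<open>p = t / (2 * N)\<close>, so
      \<open>1 - 2 * p\<close> is \<open>(N - t) / N\<close>.\<close>
    then have kraw: "(\<lambda>j. kraw (d (r j)) (t * D (r j)) k) \<longlonglongrightarrow> (1 - real t / real N) ^ k" for k
      using kraw_tendsto[OF d_inf, of "\<lambda>j. t * D (r j)" "real t / (2 * real N)" k] by simp
    have "\<bar>\<psi> (real N - real t) - (\<Sum>k<m. l k * (1 - real t / real N) ^ k)\<bar> \<le>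
      \<psi> (real N) * ((\<Sum>i\<le>m. real (m choose i) * (1 - real t / real N) ^ (2 * i)) / 2 ^ m)"
    proof (rule tendsto_le[OF sequentially_bot])
      show "(\<lambda>j. \<bar>\<psi> (real N - real t) - (\<Sum>k<m. c (r j) k * kraw (d (r j)) (t * D (r j)) k)\<bar>)
          \<longlonglongrightarrow> \<bar>\<psi> (real N - real t) - (\<Sum>k<m. l k * (1 - real t / real N) ^ k)\<bar>"
        by (intro tendsto_intros l kraw)
      show "(\<lambda>j. \<psi> (real N) * ((\<Sum>i\<le>m. real (m choose i) * kraw (d (r j)) (t * D (r j)) (2 * i)) / 2 ^ m))
          \<longlonglongrightarrow> \<psi> (real N) * ((\<Sum>i\<le>m. real (m choose i) * (1 - real t / real N) ^ (2 * i)) / 2 ^ m)"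
        by (intro tendsto_intros kraw) auto
      show "\<forall>\<^sub>F j in sequentially.
          \<bar>\<psi> (real N - real t) - (\<Sum>k<m. c (r j) k * kraw (d (r j)) (t * D (r j)) k)\<bar> \<le>
          \<psi> (real N) * ((\<Sum>i\<le>m. real (m choose i) * kraw (d (r j)) (t * D (r j)) (2 * i)) / 2 ^ m)"
        using D_inf[unfolded filterlim_at_top, rule_format, of m]
        by eventually_elim (rule approx[OF t])
    qed
    also have "(\<Sum>i\<le>m. real (m choose i) * (1 - real t / real N) ^ (2 * i)) / 2 ^ m =
        (((1 - real t / real N)\<^sup>2 + 1) / 2) ^ m"
      using binomial_ring[of "(1 - real t / real N)\<^sup>2" 1 m] by (simp add: power_mult power_divide)
    finally show ?thesis .
  qed
  show ?thesis
  proof (rule that[of "\<lambda>k. l k / real N ^ k"])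
    show "l k / real N ^ k \<ge> 0" for k using l0 by simp
    fix x :: real assume x: "x \<in> \<int>" "\<bar>x\<bar> < real N"
    then obtain i :: int where i: "x = of_int i" by (auto elim: Ints_cases)
    define t where "t = nat (int N - i)"
    have "\<bar>i\<bar> < int N" using x(2) i by linarith
    then have t: "t \<le> 2 * N" "real N - real t = x" by (auto simp: t_def i)
    then have xN: "1 - real t / real N = x / real N" using N by (simp add: field_simps)
    have "\<bar>x / real N\<bar> < 1" using x N by (simp add: abs_divide)
    then have "(x / real N)\<^sup>2 < 1" by (simp add: abs_square_less_1)
    then have "(\<lambda>k. l k * (x / real N) ^ k) sums \<psi> x"
      using bound[OF t(1)] unfolding xN t(2)
      by (intro sums_of_partial_sum_bound[where q = "((x / real N)\<^sup>2 + 1) / 2"]) auto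
    then show "(\<lambda>k. l k / real N ^ k * x ^ k) sums \<psi> x"
      by (simp add: power_divide)
  qed
qed

text \<open>Summability at arbitrarily large integers makes the radius of convergence infinite, and
  the limsup is its reciprocal (Cauchy-Hadamard).\<close>

lemma limsup_root_eq_0:
  fixes a :: "nat \<Rightarrow> real"
  assumes a: "\<And>k. a k \<ge> 0" and sm: "\<And>x. x \<in> \<int> \<Longrightarrow> summable (\<lambda>k. a k * x ^ k)"
  shows "limsup (\<lambda>n. ereal (root n (a n))) = 0"
proof -
  have "conv_radius a \<ge> ereal (real n)" for n
    using conv_radius_geI[OF sm[of "real n"]] by simp
  then have "conv_radius a = \<infinity>"
    by (metis ereal_top le_cases reals_Archimedean2 ereal_less_eq(3) less_imp_le order_trans)
  then show ?thesis
    using a by (simp add: conv_radius_def)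
qed

theorem theorem1p1:
  fixes \<psi> :: "real \<Rightarrow> real"
  assumes "partial_positivity_preserver \<int> \<psi>"
  shows "\<exists>a :: nat \<Rightarrow> real.
           (\<forall>i. a i \<ge> 0) \<and>
           limsup (\<lambda>n. ereal (root n (a n))) = 0 \<and>
           (\<forall>x\<in>\<int>. (\<lambda>i. a i * x ^ i) sums \<psi> x)"
proof -
  have "\<exists>b. (\<forall>k. b k \<ge> 0) \<and> (\<forall>x\<in>\<int>. \<bar>x\<bar> < real (Suc N) \<longrightarrow> (\<lambda>k. b k * x ^ k) sums \<psi> x)" for N
    by (rule sums_on_bounded_integers[OF assms, of "Suc N"]) auto
  then obtain b where b0: "\<And>N k. b N k \<ge> 0"
    and b: "\<And>N x. x \<in> \<int> \<Longrightarrow> \<bar>x\<bar> < real (Suc N) \<Longrightarrow> (\<lambda>k. b N k * x ^ k) sums \<psi> x"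
    by metis
  \<comment> \<open>Terms at a nonnegative integer are nonnegative, so the value of \<psi> there
    bounds finite sums uniformly in \<open>N\<close>.\<close>
  have partial_sum_le: "(\<Sum>k\<in>A. b N k * real M ^ k) \<le> \<psi> (real M)" if "M < Suc N" "finite A" for M N A
  proof -
    have "(\<lambda>k. b N k * real M ^ k) sums \<psi> (real M)" using that by (intro b) auto
    then show ?thesis
      using sum_le_suminf[of "\<lambda>k. b N k * real M ^ k" A] b0 that
      by (auto simp: sums_iff)
  qed
  \<comment> \<open>The point 1 lies in the range of the series only from \<open>N = 1\<close> on;
    \<open>b 0 k\<close> covers the remaining index.\<close>
  have "b N k \<le> max (b 0 k) (\<psi> 1)" for N k
    using partial_sum_le[of 1 N "{k}"] by (cases N) auto
  then have "Bseq (\<lambda>N. b N k)" for k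
    using b0 by (intro BseqI'[of _ "max (b 0 k) (\<psi> 1)"]) auto
  then obtain r a where r: "strict_mono r" and a: "\<And>k. (\<lambda>j. b (r j) k) \<longlonglongrightarrow> a k"
    using diagonal_convergent_subsequence[of b] by blast
  have a0: "a k \<ge> 0" for k
    using a[of k] b0 by (intro LIMSEQ_le_const) auto
  have sums: "(\<lambda>k. a k * x ^ k) sums \<psi> x" if x: "x \<in> \<int>" for x
  proof -
    \<comment> \<open>A comparison point strictly beyond |x|: the terms at \<open>M\<close> are
      controlled by the value of \<psi> there, and the gap between |x| and \<open>M\<close> supplies
      the geometric factor.\<close>
    obtain M :: nat where M: "\<bar>x\<bar> < real M" using reals_Archimedean2 by blast
    then have M0: "M > 0" by (cases M) auto
    define q where "q = \<bar>x\<bar> / real M"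
    have q: "0 \<le> q" "q < 1" using M M0 by (auto simp: q_def)
    have "\<bar>\<psi> x - (\<Sum>k<m. a k * x ^ k)\<bar> \<le> \<psi> (real M) * q ^ m" for m
    proof (rule tendsto_upperbound[OF _ _ sequentially_bot])
      show "(\<lambda>j. \<bar>\<psi> x - (\<Sum>k<m. b (r j) k * x ^ k)\<bar>) \<longlonglongrightarrow> \<bar>\<psi> x - (\<Sum>k<m. a k * x ^ k)\<bar>"
        by (intro tendsto_intros a)
      \<comment> \<open>The tail bound does not depend on \<open>N\<close>, so it survives the limit
        along \<open>r\<close>. The tail itself is approached through finite blocks of
        terms.\<close>
      have "\<bar>\<psi> x - (\<Sum>k<m. b N k * x ^ k)\<bar> \<le> \<psi> (real M) * q ^ m" if N: "N \<ge> M" for N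
      proof -
        have "(\<lambda>n. \<bar>(\<Sum>k<n. b N k * x ^ k) - (\<Sum>k<m. b N k * x ^ k)\<bar>) \<longlonglongrightarrow>
            \<bar>\<psi> x - (\<Sum>k<m. b N k * x ^ k)\<bar>"
          using b[OF x, of N] M N unfolding sums_def by (intro tendsto_intros) auto
        moreover have "\<bar>(\<Sum>k<n. b N k * x ^ k) - (\<Sum>k<m. b N k * x ^ k)\<bar> \<le> \<psi> (real M) * q ^ m"
          if "n \<ge> m" for n
        proof -
          have "(\<Sum>k<n. b N k * x ^ k) - (\<Sum>k<m. b N k * x ^ k) = (\<Sum>k=m..<n. b N k * x ^ k)"
            using sum_diff[of "{..<n}" "{..<m}" "\<lambda>k. b N k * x ^ k"] that
            by (auto intro: arg_cong[where f = "sum _"])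
          also have "\<bar>\<dots>\<bar> \<le> (\<Sum>k=m..<n. b N k * real M ^ k * q ^ m)"
          proof (intro order.trans[OF sum_abs] sum_mono)
            fix k assume k: "k \<in> {m..<n}"
            have "\<bar>x\<bar> ^ k = real M ^ k * q ^ k"
              using M0 by (simp add: q_def power_divide)
            also have "\<dots> \<le> real M ^ k * q ^ m"
              using k q by (intro mult_left_mono power_decreasing) auto
            finally show "\<bar>b N k * x ^ k\<bar> \<le> b N k * real M ^ k * q ^ m"
              using b0[of N k] by (simp add: abs_mult power_abs mult.assoc mult_left_mono)
          qed
          also have "\<dots> = (\<Sum>k=m..<n. b N k * real M ^ k) * q ^ m"
            by (simp add: sum_distrib_right)
          also have "\<dots> \<le> \<psi> (real M) * q ^ m"
            using partial_sum_le[of M N] N q by (intro mult_right_mono) auto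
          finally show ?thesis .
        qed
        ultimately show ?thesis
          by (intro tendsto_upperbound[OF _ _ sequentially_bot])
            (auto simp: eventually_sequentially)
      qed
      moreover have "\<forall>\<^sub>F j in sequentially. r j \<ge> M"
        using filterlim_subseq[OF r] by (simp add: filterlim_at_top)
      ultimately show "\<forall>\<^sub>F j in sequentially.
          \<bar>\<psi> x - (\<Sum>k<m. b (r j) k * x ^ k)\<bar> \<le> \<psi> (real M) * q ^ m"
        by (auto elim: eventually_mono)
    qed
    then show ?thesis using q by (intro sums_of_partial_sum_bound) auto
  qed
  then have "limsup (\<lambda>n. ereal (root n (a n))) = 0"
    by (intro limsup_root_eq_0 a0) (auto simp: sums_iff)
  then show ?thesis using a0 sums by blast
qed

end
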